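(* Let $x\in\mathbb{R}^n$ be strictly feasible, i.e. $f_i(x)<0$ for all $i\in\{1,\dots,m\}$. Let $\widehat{\nabla f}_0(x),\dots,\widehat{\nabla f}_m(x)\in\mathbb{R}^n$ be gradient estimates at $x$ satisfying $\|\nabla f_i(x)-\widehat{\nabla f}_i(x)\|\le\epsilon_i$ for all $i\in\{0,\dots,m\}$, and let $u(x)$ be the optimizer of the robust subproblem $$\min_{u\in\mathbb{R}^n}\ \tfrac12\|u\|^2+\widehat{\nabla f}_0(x)^\top u+\epsilon_0\|u\|\quad\text{s.t.}\quad \widehat{\nabla f}_i(x)^\top u+\epsilon_i\|u\|+\alpha f_i(x)+w_i\|u\|^2\le 0,\quad i\in\{1,\dots,m\}.$$ Then $$\nabla f_0(x)^\top u(x)\le -\|u(x)\|^2 .$$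
   Context: $\|\cdot\|$ is the Euclidean norm. The underlying problem is $f^\star=\min_x\{f_0(x)\ :\ f_i(x)\le 0,\ i\in\{1,\dots,m\}\}$, where $f_0,\dots,f_m:\mathbb{R}^n\to\mathbb{R}$; the value $f^\star>-\infty$ is attained at some feasible point. The feasible set is $\mathcal F=\{x: f_i(x)\le 0,\ i\in\{1,\dots,m\}\}$. The constants $\epsilon_0,\dots,\epsilon_m>0$, $\alpha>0$, $w_1,\dots,w_m>0$ are fixed. Standing assumptions. (Smoothness) Each $f_i$, $i\in\{0,\dots,m\}$, is continuously differentiable with $L_i$-Lipschitz gradient on $\mathbb{R}^n$. (MFCQ) For every $x\in\mathcal F$ there is $d\in\mathbb{R}^n$ with $\nabla f_i(x)^\top d<0$ for all $i\in\{1,\dots,m\}$ with $f_i(x)=0$. *)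

theory Defs
  imports "HOL-Analysis.Analysis"
begin

text \<open>The objective is \<open>f 0\<close>; the constraint functions are \<open>f 1, ..., f m\<close>.\<close>

definition feasible_set :: "nat \<Rightarrow> (nat \<Rightarrow> real^'n \<Rightarrow> real) \<Rightarrow> (real^'n) set" where
  "feasible_set m f = {x. \<forall>i\<in>{1..m}. f i x \<le> 0}"

definition strictly_feasible :: "nat \<Rightarrow> (nat \<Rightarrow> real^'n \<Rightarrow> real) \<Rightarrow> real^'n \<Rightarrow> bool" where
  "strictly_feasible m f x \<longleftrightarrow> (\<forall>i\<in>{1..m}. f i x < 0)"

definition smooth_with :: "real \<Rightarrow> (real^'n \<Rightarrow> real) \<Rightarrow> (real^'n \<Rightarrow> real^'n) \<Rightarrow> bool" where
  "smooth_with L g dg \<longleftrightarrow>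
     (\<forall>x. GDERIV g x :> dg x) \<and> continuous_on UNIV dg \<and> L-lipschitz_on UNIV dg"

definition MFCQ ::
  "nat \<Rightarrow> (nat \<Rightarrow> real^'n \<Rightarrow> real) \<Rightarrow> (nat \<Rightarrow> real^'n \<Rightarrow> real^'n) \<Rightarrow> bool" where
  "MFCQ m f grad \<longleftrightarrow>
     (\<forall>x\<in>feasible_set m f. \<exists>d. \<forall>i\<in>{1..m}. f i x = 0 \<longrightarrow> grad i x \<bullet> d < 0)"

text \<open>In the subproblem at a fixed base point, \<open>g i\<close> is the estimate of the gradient of \<open>f i\<close>
  at that point and \<open>c i\<close> is the value of \<open>f i\<close> there.\<close>

definition robust_objective ::
  "(nat \<Rightarrow> real) \<Rightarrow> (nat \<Rightarrow> real^'n) \<Rightarrow> real^'n \<Rightarrow> real" where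
  "robust_objective \<epsilon> g u = 1/2 * (norm u)\<^sup>2 + g 0 \<bullet> u + \<epsilon> 0 * norm u"

definition robust_feasible ::
  "nat \<Rightarrow> (nat \<Rightarrow> real) \<Rightarrow> real \<Rightarrow> (nat \<Rightarrow> real) \<Rightarrow> (nat \<Rightarrow> real) \<Rightarrow> (nat \<Rightarrow> real^'n)
     \<Rightarrow> real^'n \<Rightarrow> bool" where
  "robust_feasible m \<epsilon> \<alpha> w c g u \<longleftrightarrow>
     (\<forall>i\<in>{1..m}. g i \<bullet> u + \<epsilon> i * norm u + \<alpha> * c i + w i * (norm u)\<^sup>2 \<le> 0)"

end

theory Submission
  imports Defs
begin

text \<open>As \<open>c i \<le> 0\<close>, the segment from \<open>0\<close> to the optimizer \<open>u\<close> is feasible, so the left derivative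
  at \<open>t = 1\<close> of the objective along \<open>t u\<close>, which is \<open>\<parallel>u\<parallel>\<^sup>2 + g 0 \<bullet> u + \<epsilon> 0 \<parallel>u\<parallel>\<close>, is not positive; and
  \<open>g 0 \<bullet> u + \<epsilon> 0 \<parallel>u\<parallel>\<close> bounds the true directional derivative from above.\<close>

text \<open>Along the ray the norm is linear in \<open>t\<close>, so the constraint at
  \<open>t *\<^sub>R u\<close> is at most \<open>t\<close> times the one at \<open>u\<close> plus
  \<open>(1 - t) * (\<alpha> * c i)\<close>: the quadratic term only gains from
  \<open>t * t \<le> t\<close>, and the remainder is not positive.\<close>

lemma robust_feasible_scaleR:
  assumes feas: "robust_feasible m \<epsilon> \<alpha> w c g u"
    and t: "0 \<le> t" "t \<le> 1"
    and "\<alpha> \<ge> 0"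
    and w: "\<And>i. i \<in> {1..m} \<Longrightarrow> w i \<ge> 0"
    and c: "\<And>i. i \<in> {1..m} \<Longrightarrow> c i \<le> 0"
  shows "robust_feasible m \<epsilon> \<alpha> w c g (t *\<^sub>R u)"
  unfolding robust_feasible_def
proof
  fix i assume i: "i \<in> {1..m}"
  let ?N = "(norm u)\<^sup>2"
  have ineq: "g i \<bullet> u + \<epsilon> i * norm u + \<alpha> * c i + w i * ?N \<le> 0"
    using feas i by (simp add: robust_feasible_def)
  have "t * t \<le> t"
    using t by (simp add: mult_left_le)
  then have quad: "t * t * (w i * ?N) \<le> t * (w i * ?N)"
    using w[OF i] by (intro mult_right_mono) auto
  have "(1 - t) * (\<alpha> * c i) \<le> 0"
    using t \<open>\<alpha> \<ge> 0\<close> c[OF i] by (simp add: mult_nonneg_nonpos)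
  moreover have "t * (g i \<bullet> u + \<epsilon> i * norm u + \<alpha> * c i + w i * ?N) \<le> 0"
    using t ineq by (simp add: mult_nonneg_nonpos)
  ultimately show "g i \<bullet> (t *\<^sub>R u) + \<epsilon> i * norm (t *\<^sub>R u) + \<alpha> * c i + w i * (norm (t *\<^sub>R u))\<^sup>2 \<le> 0"
    using quad t by (simp add: algebra_simps power2_eq_square)
qed

lemma quadratic_slope_nonpos_at_right_min:
  fixes a b :: real
  assumes "a \<ge> 0"
    and le: "\<And>t. 0 \<le> t \<Longrightarrow> t \<le> 1 \<Longrightarrow> 1/2 * a + b \<le> 1/2 * (t\<^sup>2 * a) + t * b"
  shows "a + b \<le> 0"
proof (rule ccontr)
  assume pos: "\<not> a + b \<le> 0"
  \<comment> \<open>Moving from \<open>1\<close> to \<open>1 - s\<close> lowers the quadratic by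
    \<open>s * (a + b - s * a / 2)\<close>. With \<open>s * a \<le> a + b\<close> this is at least
    \<open>s * (a + b) / 2 > 0\<close>. For \<open>a = 0\<close> the quotient would be
    \<open>0\<close> and the step would vanish; the function is then linear, so the full step
    serves.\<close>
  define s where "s = (if a = 0 then 1 else min 1 ((a + b) / a))"
  have s: "0 < s" "s \<le> 1" and sa: "s * a \<le> a + b"
    using pos \<open>a \<ge> 0\<close> by (auto simp: s_def min_def field_simps)
  have "s * (a + b - s * a / 2) \<le> 0"
    using le[of "1 - s"] s by (simp add: power2_eq_square algebra_simps)
  then have "a + b \<le> s * a / 2"
    using s by (simp add: mult_le_0_iff)
  then show False
    using pos sa by linarith
qed

lemma robust_optimizer_slope:
  assumes min: "is_arg_min (robust_objective \<epsilon> g) (robust_feasible m \<epsilon> \<alpha> w c g) u"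
    and "\<alpha> \<ge> 0"
    and "\<And>i. i \<in> {1..m} \<Longrightarrow> w i \<ge> 0"
    and "\<And>i. i \<in> {1..m} \<Longrightarrow> c i \<le> 0"
  shows "(norm u)\<^sup>2 + (g 0 \<bullet> u + \<epsilon> 0 * norm u) \<le> 0"
proof (rule quadratic_slope_nonpos_at_right_min)
  fix t :: real assume t: "0 \<le> t" "t \<le> 1"
  have "robust_feasible m \<epsilon> \<alpha> w c g (t *\<^sub>R u)"
    using min t assms(2-4) by (intro robust_feasible_scaleR) (simp_all add: is_arg_min_def)
  then have "robust_objective \<epsilon> g u \<le> robust_objective \<epsilon> g (t *\<^sub>R u)"
    using min by (auto simp: is_arg_min_linorder)
  \<comment> \<open>Since \<open>norm (t *\<^sub>R u) = t * norm u\<close> for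
    \<open>t \<ge> 0\<close>, the objective on the segment is an exact quadratic in
    \<open>t\<close>, despite the kink of the norm at the origin.\<close>
  then show "1/2 * (norm u)\<^sup>2 + (g 0 \<bullet> u + \<epsilon> 0 * norm u)
      \<le> 1/2 * (t\<^sup>2 * (norm u)\<^sup>2) + t * (g 0 \<bullet> u + \<epsilon> 0 * norm u)"
    using t by (simp add: robust_objective_def power_mult_distrib algebra_simps)
qed simp

theorem theorem1:
  fixes m :: nat
    and f :: "nat \<Rightarrow> real^'n \<Rightarrow> real"
    and grad :: "nat \<Rightarrow> real^'n \<Rightarrow> real^'n"
    and L \<epsilon> w :: "nat \<Rightarrow> real"
    and \<alpha> :: real
    and x u :: "real^'n"
    and g :: "nat \<Rightarrow> real^'n"
  assumes "\<exists>xs. is_arg_min (f 0) (\<lambda>y. y \<in> feasible_set m f) xs"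
    and "\<And>i. i \<in> {0..m} \<Longrightarrow> smooth_with (L i) (f i) (grad i)"
    and "MFCQ m f grad"
    and "\<And>i. i \<in> {0..m} \<Longrightarrow> \<epsilon> i > 0"
    and "\<alpha> > 0"
    and "\<And>i. i \<in> {1..m} \<Longrightarrow> w i > 0"
    and "strictly_feasible m f x"
    and "\<And>i. i \<in> {0..m} \<Longrightarrow> norm (grad i x - g i) \<le> \<epsilon> i"
    and "is_arg_min (robust_objective \<epsilon> g) (robust_feasible m \<epsilon> \<alpha> w (\<lambda>i. f i x) g) u"
  shows "grad 0 x \<bullet> u \<le> - ((norm u)\<^sup>2)"
proof -
  \<comment> \<open>The gradient error costs at most \<open>\<epsilon> 0 * norm u\<close>, which is
    precisely the robustness term in the objective.\<close>
  have "(grad 0 x - g 0) \<bullet> u \<le> norm (grad 0 x - g 0) * norm u"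
    by (rule norm_cauchy_schwarz)
  also have "\<dots> \<le> \<epsilon> 0 * norm u"
    using assms(8)[of 0] by (intro mult_right_mono) auto
  finally have "grad 0 x \<bullet> u \<le> g 0 \<bullet> u + \<epsilon> 0 * norm u"
    by (simp add: inner_diff_left)
  moreover have "(norm u)\<^sup>2 + (g 0 \<bullet> u + \<epsilon> 0 * norm u) \<le> 0"
    using assms(5-7,9) by (intro robust_optimizer_slope) (auto simp: strictly_feasible_def less_imp_le)
  ultimately show ?thesis
    by linarith
qed

end
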